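(* In each time slot $n$, the charging powers $\{P_i(n)\}_{i=1}^N$ computed by the On-line Decentralized PEV Charging algorithm (Algorithm 1, described in the context) solve the following optimization problem: $$\max_{\{P_i\}}\ \sum_{i=1}^N (U_i(n-1)+C_i)\,\eta_iP_i\Delta t-\beta\Big(S_{\text{net}}(n)+\sum_{i=1}^N P_i\Big)^2$$ subject to, for $1\le i\le N$: $0\le P_i\le P_i^{\max}$; $P_i\eta_i\Delta t\le U_i(n-1)$; and $P_i=0$ if $\chi_i(n)=0$. Here, in the case that the battery of PEV $i$ becomes fully charged in the middle of a time slot, $P_i(n)$ is interpreted as the average charging power $P_i(n)=U_i(n-1)/(\eta_i\Delta t)$ for that time slot.
   Context: There are $N$ plug-in electric vehicles (PEVs); time is slotted with slot length $\Delta t>0$. $S_{\text{net}}(n)$ is the total net base load in slot $n$. For PEV $i$: $U_i(n)\ge0$ is the energy queue length (energy needed to refill the battery), $P_i(n)$ the charging power, $P_i^{\max}$ the maximum charging power, $\eta_i>0$ the charging efficiency, $\chi_i(n)\in\{0,1\}$ the indicator that PEV $i$ is plugged in during slot $n$, $C_i$ a constant (charging reference offset). $\beta>0$ is a constant weight of the charging cost. Algorithm 1 (executed in each slot $n$): Step 1. Each plugged-in PEV initializes $P_i\gets0$ (PEVs not plugged in have $P_i=0$ throughout); lower and upper bounds $U_{\text{ref}}^{\min},U_{\text{ref}}^{\max}$ on the charging reference are given, and the aggregator sets the charging reference $U_{\text{ref}}\gets(U_{\text{ref}}^{\min}+U_{\text{ref}}^{\max})/2$. Step 2. Each plugged-in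 vehicle sets $P_i\gets0$ if $U_i(n-1)\le U_{\text{ref}}/(\eta_i\Delta t)-C_i$, and $P_i\gets P_i^{\max}$ otherwise. Step 3. Each vehicle submits $P_i$ to the aggregator. If $U_{\text{ref}}>2\beta\big(S_{\text{net}}(n)+\sum_{i=1}^NP_i\big)$, the aggregator sets $U_{\text{ref}}^{\max}\gets U_{\text{ref}}$; otherwise it sets $U_{\text{ref}}^{\min}\gets U_{\text{ref}}$. Step 4. $U_{\text{ref}}$ is broadcast to the vehicles. If $|U_{\text{ref}}^{\min}-U_{\text{ref}}^{\max}|<\varepsilon'$ (a tolerance), stop; otherwise reset $U_{\text{ref}}\gets(U_{\text{ref}}^{\min}+U_{\text{ref}}^{\max})/2$ and go to Step 2. (A battery does not charge further once it is full.)
   Formalization: Added assumptions: some U_ref between the initial bounds equals 2β(S_net+ΣP_i) for its own Step 2 powers, and no vehicle's power changes within ε' of it (else false: the optimum may need a fractional P_i). Vehicles submit the average power to the aggregator when the battery fills mid-slot. *)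

theory Defs
  imports Complex_Main "HOL-Library.While_Combinator"
begin

text \<open>
  The vehicles are numbered 1 to N. Per-vehicle data is a function of the vehicle index, and of the
  slot where it varies over time; values at indices outside 1..N are irrelevant.
\<close>

record pev_system =
  num_pev    :: nat                            \<comment> \<open>N\<close>
  slot       :: real                           \<comment> \<open>slot length (Delta t)\<close>
  cost       :: real                           \<comment> \<open>weight beta of the charging cost\<close>
  net_load   :: "nat \<Rightarrow> real"             \<comment> \<open>net base load, by slot\<close>
  max_power  :: "nat \<Rightarrow> real"             \<comment> \<open>by vehicle\<close>
  efficiency :: "nat \<Rightarrow> real"             \<comment> \<open>eta, by vehicle\<close>
  offset     :: "nat \<Rightarrow> real"             \<comment> \<open>charging reference offset C, by vehicle\<close>
  queue      :: "nat \<Rightarrow> nat \<Rightarrow> real"      \<comment> \<open>energy queue length U, by vehicle and slot\<close>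
  plugged    :: "nat \<Rightarrow> nat \<Rightarrow> nat"       \<comment> \<open>indicator chi, by vehicle and slot\<close>

definition valid_system :: "pev_system \<Rightarrow> bool" where
  "valid_system S \<longleftrightarrow>
     slot S > 0 \<and> cost S > 0 \<and>
     (\<forall>i\<in>{1..num_pev S}. efficiency S i > 0 \<and> max_power S i \<ge> 0 \<and>
        (\<forall>n. queue S i n \<ge> 0 \<and> plugged S i n \<in> {0, 1}))"

definition objective :: "pev_system \<Rightarrow> nat \<Rightarrow> (nat \<Rightarrow> real) \<Rightarrow> real" where
  "objective S n P =
     (\<Sum>i=1..num_pev S. (queue S i (n - 1) + offset S i) * efficiency S i * P i * slot S)
     - cost S * (net_load S n + (\<Sum>i=1..num_pev S. P i))\<^sup>2"

definition feasible :: "pev_system \<Rightarrow> nat \<Rightarrow> (nat \<Rightarrow> real) \<Rightarrow> bool" where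
  "feasible S n P \<longleftrightarrow>
     (\<forall>i\<in>{1..num_pev S}.
        0 \<le> P i \<and> P i \<le> max_power S i \<and>
        P i * efficiency S i * slot S \<le> queue S i (n - 1) \<and>
        (plugged S i n = 0 \<longrightarrow> P i = 0))"

text \<open>
  A battery stops charging once it is full. If drawing power p for a whole slot would overfill
  battery i, the power of that vehicle is understood as its average over the slot, that is, the
  power which exactly empties the energy queue. This is the value the vehicle submits to the
  aggregator as well as the value the algorithm computes.
\<close>

definition average_power :: "pev_system \<Rightarrow> nat \<Rightarrow> nat \<Rightarrow> real \<Rightarrow> real" where
  "average_power S n i p =
     (if queue S i (n - 1) < p * efficiency S i * slot S
      then queue S i (n - 1) / (efficiency S i * slot S) else p)"

definition response :: "pev_system \<Rightarrow> nat \<Rightarrow> real \<Rightarrow> nat \<Rightarrow> real" where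
  "response S n ref i =
     (if plugged S i n = 0 then 0
      else if queue S i (n - 1) \<le> ref / (efficiency S i * slot S) - offset S i then 0
      else average_power S n i (max_power S i))"

definition marginal_cost :: "pev_system \<Rightarrow> nat \<Rightarrow> (nat \<Rightarrow> real) \<Rightarrow> real" where
  "marginal_cost S n P = 2 * cost S * (net_load S n + (\<Sum>i=1..num_pev S. P i))"

record alg_state =
  ref_min :: real
  ref_max :: real
  ref     :: real
  power   :: "nat \<Rightarrow> real"

definition set_ref :: "alg_state \<Rightarrow> alg_state" where
  "set_ref s = s\<lparr>ref := (ref_min s + ref_max s) / 2\<rparr>"

text \<open>The reference 0 is a placeholder, overwritten by \<open>set_ref\<close>.\<close>

definition init_state :: "real \<Rightarrow> real \<Rightarrow> alg_state" where
  "init_state lo hi = set_ref \<lparr>ref_min = lo, ref_max = hi, ref = 0, power = (\<lambda>_. 0)\<rparr>"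

definition update_power :: "pev_system \<Rightarrow> nat \<Rightarrow> alg_state \<Rightarrow> alg_state" where
  "update_power S n s = s\<lparr>power := response S n (ref s)\<rparr>"

definition update_bounds :: "pev_system \<Rightarrow> nat \<Rightarrow> alg_state \<Rightarrow> alg_state" where
  "update_bounds S n s =
     (if ref s > marginal_cost S n (power s) then s\<lparr>ref_max := ref s\<rparr> else s\<lparr>ref_min := ref s\<rparr>)"

definition charging_round :: "pev_system \<Rightarrow> nat \<Rightarrow> alg_state \<Rightarrow> alg_state" where
  "charging_round S n s = update_bounds S n (update_power S n s)"

text \<open>
  The stopping test comes after each round, so one round is performed unconditionally. The result
  is \<open>None\<close> if the loop does not terminate.
\<close>

definition charging_algorithm ::
    "pev_system \<Rightarrow> nat \<Rightarrow> real \<Rightarrow> real \<Rightarrow> real \<Rightarrow> (nat \<Rightarrow> real) option" where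
  "charging_algorithm S n tol lo hi =
     map_option power
       (while_option (\<lambda>s. \<not> \<bar>ref_min s - ref_max s\<bar> < tol)
          (\<lambda>s. charging_round S n (set_ref s))
          (charging_round S n (init_state lo hi)))"

end

theory Submission
  imports Defs
begin

text \<open>
  Every response is antitone in the reference, hence so is its marginal cost. Comparing the
  reference with the marginal cost of the response therefore tells on which side of the equilibrium
  the reference lies, and the algorithm is a bisection that keeps the equilibrium between its
  bounds. The equilibrium is the Lagrange multiplier of the problem: by convexity of the quadratic
  cost, the loss of a competitor is at least a sum over the vehicles of
  (weight minus equilibrium) times the difference in power, and the threshold rule makes
  each summand nonnegative.
\<close>

lemma average_power_eq_min:
  assumes "efficiency S i * slot S > 0"
  shows "average_power S n i p = min p (queue S i (n - 1) / (efficiency S i * slot S))"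
  using assms by (auto simp: average_power_def min_def field_simps)

text \<open>Clearing the denominator turns the switching rule into a comparison of \<open>r\<close>
  with the coefficient of the vehicle's power in \<open>objective\<close>. The \<open>min\<close> is
  the largest power that the rating and the queue allow.\<close>

lemma response_eq:
  assumes "efficiency S i * slot S > 0"
  shows "response S n r i =
    (if plugged S i n = 0 \<or> (queue S i (n - 1) + offset S i) * efficiency S i * slot S \<le> r then 0
     else min (max_power S i) (queue S i (n - 1) / (efficiency S i * slot S)))"
proof -
  have "queue S i (n - 1) \<le> r / (efficiency S i * slot S) - offset S i \<longleftrightarrow>
      queue S i (n - 1) + offset S i \<le> r / (efficiency S i * slot S)"
    by linarith
  also have "\<dots> \<longleftrightarrow> (queue S i (n - 1) + offset S i) * efficiency S i * slot S \<le> r"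
    using pos_le_divide_eq[OF assms] by (simp only: mult.assoc)
  finally show ?thesis
    unfolding response_def average_power_eq_min[OF assms] by simp
qed

lemma valid_systemD:
  assumes "valid_system S" and "i \<in> {1..num_pev S}"
  shows "efficiency S i * slot S > 0" "max_power S i \<ge> 0" "queue S i n \<ge> 0"
  using assms by (auto simp: valid_system_def)

lemma response_antimono:
  assumes "valid_system S" and "i \<in> {1..num_pev S}" and "r \<le> r'"
  shows "response S n r' i \<le> response S n r i"
  using valid_systemD[OF assms(1,2)] assms(3) by (auto simp: response_eq)

lemma feasible_response:
  assumes "valid_system S"
  shows "feasible S n (response S n r)"
  unfolding feasible_def
proof
  fix i assume i: "i \<in> {1..num_pev S}"
  note pos = valid_systemD[OF assms i]
  let ?m = "min (max_power S i) (queue S i (n - 1) / (efficiency S i * slot S))"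
  have "?m * (efficiency S i * slot S) \<le> queue S i (n - 1)"
    using pos(1) by (simp add: pos_le_divide_eq[symmetric])
  with pos show "0 \<le> response S n r i \<and> response S n r i \<le> max_power S i \<and>
      response S n r i * efficiency S i * slot S \<le> queue S i (n - 1) \<and>
      (plugged S i n = 0 \<longrightarrow> response S n r i = 0)"
    by (simp add: response_eq mult.assoc)
qed

lemma marginal_cost_response_antimono:
  assumes "valid_system S" and "r \<le> r'"
  shows "marginal_cost S n (response S n r') \<le> marginal_cost S n (response S n r)"
proof -
  have "(\<Sum>i=1..num_pev S. response S n r' i) \<le> (\<Sum>i=1..num_pev S. response S n r i)"
    using assms by (intro sum_mono response_antimono)
  moreover have "cost S > 0" using assms(1) by (simp add: valid_system_def)
  ultimately show ?thesis unfolding marginal_cost_def by simp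
qed

lemma response_arg_max:
  assumes valid: "valid_system S" and eq: "r = marginal_cost S n (response S n r)"
  shows "is_arg_max (objective S n) (feasible S n) (response S n r)"
proof -
  let ?P = "response S n r"
  let ?w = "\<lambda>i. (queue S i (n - 1) + offset S i) * efficiency S i * slot S"
  have "objective S n Q \<le> objective S n ?P" if Q: "feasible S n Q" for Q
  proof -
    have termwise: "0 \<le> (?w i - r) * (?P i - Q i)" if i: "i \<in> {1..num_pev S}" for i
    proof -
      note pos = valid_systemD[OF valid i]
      have f: "0 \<le> Q i" "Q i \<le> max_power S i" "plugged S i n = 0 \<longrightarrow> Q i = 0"
        "Q i \<le> queue S i (n - 1) / (efficiency S i * slot S)"
        using Q i pos(1) by (auto simp: feasible_def pos_le_divide_eq mult.assoc)
      show ?thesis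
      \<comment> \<open>At or below the threshold \<open>?P i\<close> is 0, so \<open>Q i\<close>
        can only be larger; above it \<open>?P i\<close> is the largest feasible value. In both
        cases the two factors do not have opposite signs.\<close>
      proof (cases "?w i \<le> r")
        case True
        then show ?thesis using f(1) by (simp add: response_eq[OF pos(1)] mult_nonpos_nonneg)
      next
        case False
        then have "Q i \<le> ?P i" using f by (simp add: response_eq[OF pos(1)])
        with False show ?thesis by simp
      qed
    qed
    define x where "x = net_load S n + (\<Sum>i=1..num_pev S. ?P i)"
    define y where "y = net_load S n + (\<Sum>i=1..num_pev S. Q i)"
    have rx: "r = 2 * cost S * x" using eq by (simp add: marginal_cost_def x_def)
    \<comment> \<open>This square is the gap at \<open>y\<close> between the quadratic cost and its
      tangent at \<open>x\<close>, whose slope is \<open>r\<close> by the equilibrium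
      equation.\<close>
    have "0 \<le> cost S * (x - y)\<^sup>2" using valid by (simp add: valid_system_def)
    also have "\<dots> = r * (x - y) - cost S * x\<^sup>2 + cost S * y\<^sup>2"
      unfolding rx by (simp add: power2_eq_square algebra_simps)
    finally have convex: "cost S * x\<^sup>2 - cost S * y\<^sup>2 \<le> r * (x - y)" by simp
    have "0 \<le> (\<Sum>i=1..num_pev S. (?w i - r) * (?P i - Q i))"
      using termwise by (rule sum_nonneg)
    also have "\<dots> = (\<Sum>i=1..num_pev S. ?w i * ?P i) - (\<Sum>i=1..num_pev S. ?w i * Q i) - r * (x - y)"
      by (simp add: x_def y_def left_diff_distrib right_diff_distrib sum_subtractf sum_distrib_left)
    finally have "(\<Sum>i=1..num_pev S. ?w i * Q i) - cost S * y\<^sup>2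
        \<le> (\<Sum>i=1..num_pev S. ?w i * ?P i) - cost S * x\<^sup>2"
      using convex by linarith
    then show ?thesis unfolding objective_def x_def y_def by (simp add: mult_ac)
  qed
  then show ?thesis
    using feasible_response[OF valid] by (auto simp: is_arg_max_def not_less)
qed

lemma is_arg_max_cong_vehicles:
  assumes "\<And>i. i \<in> {1..num_pev S} \<Longrightarrow> P i = Q i"
    and "is_arg_max (objective S n) (feasible S n) Q"
  shows "is_arg_max (objective S n) (feasible S n) P"
proof -
  have "objective S n P = objective S n Q"
    unfolding objective_def using assms(1) by simp
  moreover have "feasible S n P = feasible S n Q"
    unfolding feasible_def using assms(1) by simp
  ultimately show ?thesis using assms(2) by (simp add: is_arg_max_def)
qed

text \<open>The loop invariant, stated for states after a complete round, when \<open>power\<close>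
  belongs to the current \<open>ref\<close>.\<close>

definition brackets :: "pev_system \<Rightarrow> nat \<Rightarrow> real \<Rightarrow> alg_state \<Rightarrow> bool" where
  "brackets S n r s \<longleftrightarrow> ref_min s \<le> r \<and> r \<le> ref_max s \<and>
     ref s \<in> {ref_min s..ref_max s} \<and> power s = response S n (ref s)"

text \<open>Only the bounds of \<open>s\<close> are constrained, so that the first round, whose
  powers start at 0, is covered as well.\<close>

lemma charging_round_set_ref:
  assumes "valid_system S" and "r = marginal_cost S n (response S n r)"
    and "ref_min s \<le> r" and "r \<le> ref_max s"
  defines "t \<equiv> charging_round S n (set_ref s)"
  shows "brackets S n r t" and "ref_max t - ref_min t = (ref_max s - ref_min s) / 2"
proof -
  define m where "m = (ref_min s + ref_max s) / 2"
  \<comment> \<open>If \<open>r < m\<close>, the marginal cost at \<open>m\<close> is at most its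
    value \<open>r\<close> at \<open>r\<close>, hence below \<open>m\<close>; if
    \<open>m \<le> r\<close>, it is at least \<open>r\<close>, hence at least
    \<open>m\<close>.\<close>
  have "m > marginal_cost S n (response S n m) \<longleftrightarrow> r < m"
    using marginal_cost_response_antimono[OF assms(1), of r m n]
      marginal_cost_response_antimono[OF assms(1), of m r n] assms(2) by fastforce
  then have t: "t = (if r < m then s\<lparr>ref := m, power := response S n m, ref_max := m\<rparr>
      else s\<lparr>ref := m, power := response S n m, ref_min := m\<rparr>)"
    by (simp add: t_def charging_round_def update_bounds_def update_power_def set_ref_def
        flip: m_def)
  have "ref_min s \<le> m" "m \<le> ref_max s"
    using assms(3,4) by (simp_all add: m_def)
  then show "brackets S n r t"
    using assms(3,4) by (simp add: t brackets_def)
  show "ref_max t - ref_min t = (ref_max s - ref_min s) / 2"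
    by (simp add: t) (simp add: m_def field_simps)
qed

lemma charging_algorithm_terminates:
  assumes valid: "valid_system S" and "tol > 0" and "lo \<le> r" and "r \<le> hi"
    and eq: "r = marginal_cost S n (response S n r)"
  obtains r' where "charging_algorithm S n tol lo hi = Some (response S n r')" "\<bar>r' - r\<bar> < tol"
proof -
  let ?b = "\<lambda>s. \<not> \<bar>ref_min s - ref_max s\<bar> < tol"
  let ?c = "\<lambda>s. charging_round S n (set_ref s)"
  let ?s = "charging_round S n (init_state lo hi)"
  \<comment> \<open>The factor 2 makes the ceiling drop strictly: while the loop runs, the relative
    width \<open>d\<close> is at least 1, so halving lowers \<open>2 * d\<close> by at least 1. The
    ceiling of \<open>d\<close> itself would stay at 1 when \<open>d = 1\<close>.\<close>
  let ?f = "\<lambda>s. nat \<lceil>2 * ((ref_max s - ref_min s) / tol)\<rceil>"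
  have init: "brackets S n r ?s"
    unfolding init_state_def using assms by (intro charging_round_set_ref) simp_all
  have step: "brackets S n r (?c s) \<and> ?f (?c s) < ?f s" if s: "brackets S n r s" "?b s" for s
  proof
    have le: "ref_min s \<le> r" "r \<le> ref_max s" using s(1) by (auto simp: brackets_def)
    show "brackets S n r (?c s)" by (rule charging_round_set_ref(1)[OF valid eq le])
    define d where "d = (ref_max s - ref_min s) / tol"
    have "1 \<le> d" using s le \<open>tol > 0\<close> by (simp add: d_def)
    then have "\<lceil>d\<rceil> < \<lceil>2 * d\<rceil>" and "0 < \<lceil>2 * d\<rceil>" by linarith+
    moreover have "2 * ((ref_max (?c s) - ref_min (?c s)) / tol) = d"
      unfolding charging_round_set_ref(2)[OF valid eq le] d_def
      by (simp del: right_diff_distrib_numeral)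
    ultimately show "?f (?c s) < ?f s"
      by (simp only: d_def[symmetric] zless_nat_conj simp_thms)
  qed
  obtain t where t: "while_option ?b ?c ?s = Some t"
    using measure_while_option_Some[where P = "brackets S n r" and f = ?f, OF step init] by (rule exE)
  have "brackets S n r t"
    by (rule while_option_rule[where P = "brackets S n r", OF conjunct1[OF step] t init])
  moreover have "\<not> ?b t" by (rule while_option_stop[OF t])
  \<comment> \<open>Both \<open>ref t\<close> and \<open>r\<close> lie between the final bounds,
    which are less than \<open>tol\<close> apart.\<close>
  ultimately have "power t = response S n (ref t)" "\<bar>ref t - r\<bar> < tol"
    by (auto simp: brackets_def)
  with t that show thesis by (simp add: charging_algorithm_def)
qed

text \<open>Responses are step functions of the reference, so the marginal cost may jump across it;
  an equilibrium is therefore assumed. Constancy of the responses within \<open>tol\<close> of it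
  makes the approximate final reference yield exactly optimal powers.\<close>

theorem theorem2:
  fixes S :: pev_system and n :: nat and tol lo hi ref_eq :: real
  assumes "valid_system S" and "n \<ge> 1" and "tol > 0"
    and "lo \<le> ref_eq" and "ref_eq \<le> hi"
    and "ref_eq = marginal_cost S n (response S n ref_eq)"
    and "\<And>r i. \<bar>r - ref_eq\<bar> < tol \<Longrightarrow> i \<in> {1..num_pev S} \<Longrightarrow> response S n r i = response S n ref_eq i"
  shows "\<exists>P. charging_algorithm S n tol lo hi = Some P \<and>
             is_arg_max (objective S n) (feasible S n) P"
proof -
  obtain r where r: "charging_algorithm S n tol lo hi = Some (response S n r)" "\<bar>r - ref_eq\<bar> < tol"
    using charging_algorithm_terminates[OF assms(1,3,4,5,6)] .
  have "is_arg_max (objective S n) (feasible S n) (response S n r)"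
    using assms(7)[OF r(2)] response_arg_max[OF assms(1,6)] by (rule is_arg_max_cong_vehicles)
  with r(1) show ?thesis by blast
qed

end
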